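(* (Factorization theorem.) Let $x\in\mathbb D$ with $x(t)\neq0$ for all $t\in\mathcal I$. If $z$ is defined on $\mathcal I$ by $$z=\frac{pD^{\alpha}x}{x},$$ then $Lx=x\,Rz$ on $\mathcal I$.
   Context: $\mathcal I\subseteq\mathbb R$ is a nondegenerate interval. The functions $\kappa_0,\kappa_1:[0,1]\times\mathcal I\to[0,\infty)$ are continuous and satisfy, for all $t\in\mathcal I$: $\lim_{\alpha\to0^+}\kappa_1(\alpha,t)=1$, $\lim_{\alpha\to0^+}\kappa_0(\alpha,t)=0$, $\lim_{\alpha\to1^-}\kappa_1(\alpha,t)=0$, $\lim_{\alpha\to1^-}\kappa_0(\alpha,t)=1$, $\kappa_1(\alpha,t)\ne0$ for $\alpha\in[0,1)$, and $\kappa_0(\alpha,t)\neq0$ for $\alpha\in(0,1]$. Fix $\alpha\in(0,1]$ and write $\kappa_j(t)=\kappa_j(\alpha,t)$. The conformable (proportional) derivative is $D^{\alpha}f(t)=\kappa_1(t)f(t)+\kappa_0(t)f'(t)$. Let $p,q$ be continuous on $\mathcal I$ with $p(t)>0$ for all $t\in\mathcal I$, and set $Lx=D^{\alpha}[pD^{\alpha}x]+qx$. $\mathbb D$ is the set of all continuous functions $x$ on $\mathcal I$ such that $D^{\alpha}x$ and $D^{\alpha}[pD^{\alpha}x]$ exist and are continuous on $\mathcal I$. The Riccati operator is $Rz=D^{\alpha}z+q+\frac{z^2}{p}-\kappa_1z$. *)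

theory Defs
  imports "HOL-Analysis.Analysis"
begin

definition nondegenerate_interval :: "real set \<Rightarrow> bool" where
  "nondegenerate_interval I \<longleftrightarrow> is_interval I \<and> (\<exists>a\<in>I. \<exists>b\<in>I. a < b)"

definition conformable_kernels ::
  "real set \<Rightarrow> (real \<Rightarrow> real \<Rightarrow> real) \<Rightarrow> (real \<Rightarrow> real \<Rightarrow> real) \<Rightarrow> bool" where
  "conformable_kernels I \<kappa>0 \<kappa>1 \<longleftrightarrow>
     continuous_on ({0..1} \<times> I) (\<lambda>(\<alpha>, t). \<kappa>0 \<alpha> t) \<and>
     continuous_on ({0..1} \<times> I) (\<lambda>(\<alpha>, t). \<kappa>1 \<alpha> t) \<and>
     (\<forall>\<alpha>\<in>{0..1}. \<forall>t\<in>I. 0 \<le> \<kappa>0 \<alpha> t \<and> 0 \<le> \<kappa>1 \<alpha> t) \<and>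
     (\<forall>t\<in>I. ((\<lambda>\<alpha>. \<kappa>1 \<alpha> t) \<longlongrightarrow> 1) (at_right 0) \<and>
            ((\<lambda>\<alpha>. \<kappa>0 \<alpha> t) \<longlongrightarrow> 0) (at_right 0) \<and>
            ((\<lambda>\<alpha>. \<kappa>1 \<alpha> t) \<longlongrightarrow> 0) (at_left 1) \<and>
            ((\<lambda>\<alpha>. \<kappa>0 \<alpha> t) \<longlongrightarrow> 1) (at_left 1) \<and>
            (\<forall>\<alpha>\<in>{0..<1}. \<kappa>1 \<alpha> t \<noteq> 0) \<and>
            (\<forall>\<alpha>\<in>{0<..1}. \<kappa>0 \<alpha> t \<noteq> 0))"

text \<open>
  Functions on the interval \<open>I\<close> are represented by total functions whose values outside \<open>I\<close> are
  irrelevant.  Accordingly, derivatives are taken within \<open>I\<close>, so they are one-sided at an endpoint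
  belonging to \<open>I\<close>.  In the definitions below, \<open>k0\<close> and \<open>k1\<close> are the sections of the kernels at a
  fixed order \<open>\<alpha>\<close>.  The value of \<open>conformable_deriv\<close> is meaningful only where \<open>f\<close> is
  differentiable within \<open>I\<close>; since \<open>k0\<close> does not vanish on \<open>I\<close> for \<open>0 < \<alpha> \<le> 1\<close>,
  this is what existence of the conformable derivative means.
\<close>

definition conformable_deriv ::
  "real set \<Rightarrow> (real \<Rightarrow> real) \<Rightarrow> (real \<Rightarrow> real) \<Rightarrow> (real \<Rightarrow> real) \<Rightarrow> real \<Rightarrow> real" where
  "conformable_deriv I k0 k1 f t = k1 t * f t + k0 t * vector_derivative f (at t within I)"

definition conformable_L ::
  "real set \<Rightarrow> (real \<Rightarrow> real) \<Rightarrow> (real \<Rightarrow> real) \<Rightarrow> (real \<Rightarrow> real) \<Rightarrow> (real \<Rightarrow> real) \<Rightarrow>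
     (real \<Rightarrow> real) \<Rightarrow> real \<Rightarrow> real" where
  "conformable_L I k0 k1 p q x t =
     conformable_deriv I k0 k1 (\<lambda>s. p s * conformable_deriv I k0 k1 x s) t + q t * x t"

definition conformable_domain ::
  "real set \<Rightarrow> (real \<Rightarrow> real) \<Rightarrow> (real \<Rightarrow> real) \<Rightarrow> (real \<Rightarrow> real) \<Rightarrow> (real \<Rightarrow> real) set" where
  "conformable_domain I k0 k1 p =
     {x. continuous_on I x \<and>
         x differentiable_on I \<and>
         continuous_on I (conformable_deriv I k0 k1 x) \<and>
         (\<lambda>s. p s * conformable_deriv I k0 k1 x s) differentiable_on I \<and>
         continuous_on I
           (conformable_deriv I k0 k1 (\<lambda>s. p s * conformable_deriv I k0 k1 x s))}"

definition riccati ::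
  "real set \<Rightarrow> (real \<Rightarrow> real) \<Rightarrow> (real \<Rightarrow> real) \<Rightarrow> (real \<Rightarrow> real) \<Rightarrow> (real \<Rightarrow> real) \<Rightarrow>
     (real \<Rightarrow> real) \<Rightarrow> real \<Rightarrow> real" where
  "riccati I k0 k1 p q z t =
     conformable_deriv I k0 k1 z t + q t + (z t)\<^sup>2 / p t - k1 t * z t"

end

theory Submission
  imports Defs
begin

text \<open>Put \<open>u = p * D x\<close>, so that \<open>z = u / x\<close> on \<open>I\<close>.
  Since the Riccati operator subtracts \<open>\<kappa>1 * z\<close>, only
  \<open>\<kappa>0 * z'\<close> survives from \<open>D z\<close>, and the quotient rule gives
  \<open>x * \<kappa>0 * z' = \<kappa>0 * u' - \<kappa>0 * u * x' / x\<close>. On the other hand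
  \<open>x * z\<^sup>2 / p = u * D x / x = \<kappa>1 * u + \<kappa>0 * u * x' / x\<close>. The cross
  terms cancel, and the sum is \<open>D u\<close>, the leading term of \<open>L x\<close>. What
  remains is to read \<open>D\<close> off actual derivatives, which is the role of
  \<open>conformable_deriv_eq\<close>.\<close>

text \<open>A connected set with more than one point has no isolated points. This makes derivatives
  within \<open>I\<close> unique, also at endpoints.\<close>

lemma nondegenerate_interval_at_within_neq_bot:
  assumes "nondegenerate_interval I" "t \<in> I"
  shows "at t within I \<noteq> bot"
proof -
  have "connected I" "I \<noteq> {t}"
    using assms(1) by (auto simp: nondegenerate_interval_def is_interval_connected)
  then show ?thesis
    using connected_imp_perfect[of I t] assms(2) by (auto simp: trivial_limit_within)
qed

text \<open>\<open>vector_derivative\<close> is a choice operator; uniqueness of the derivative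
  within \<open>I\<close> forces it to pick the given \<open>f'\<close>.\<close>

lemma conformable_deriv_eq:
  assumes "nondegenerate_interval I" "t \<in> I"
    and "(f has_real_derivative f') (at t within I)"
  shows "conformable_deriv I k0 k1 f t = k1 t * f t + k0 t * f'"
proof -
  have "vector_derivative f (at t within I) = f'"
    using assms nondegenerate_interval_at_within_neq_bot
    by (intro vector_derivative_within)
      (auto simp: has_real_derivative_iff_has_vector_derivative)
  then show ?thesis
    by (simp add: conformable_deriv_def)
qed

theorem theorem6p3:
  fixes I :: "real set"
    and \<kappa>0 \<kappa>1 :: "real \<Rightarrow> real \<Rightarrow> real"
    and \<alpha> :: real
    and p q x z :: "real \<Rightarrow> real"
  assumes "nondegenerate_interval I"
    and "conformable_kernels I \<kappa>0 \<kappa>1"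
    and "0 < \<alpha>" and "\<alpha> \<le> 1"
    and "continuous_on I p" and "continuous_on I q"
    and "\<And>t. t \<in> I \<Longrightarrow> 0 < p t"
    and "x \<in> conformable_domain I (\<kappa>0 \<alpha>) (\<kappa>1 \<alpha>) p"
    and "\<And>t. t \<in> I \<Longrightarrow> x t \<noteq> 0"
    and "\<And>t. t \<in> I \<Longrightarrow> z t = p t * conformable_deriv I (\<kappa>0 \<alpha>) (\<kappa>1 \<alpha>) x t / x t"
  shows "z differentiable_on I \<and>
    (\<forall>t\<in>I. conformable_L I (\<kappa>0 \<alpha>) (\<kappa>1 \<alpha>) p q x t
             = x t * riccati I (\<kappa>0 \<alpha>) (\<kappa>1 \<alpha>) p q z t)"
proof -
  define D where "D = conformable_deriv I (\<kappa>0 \<alpha>) (\<kappa>1 \<alpha>)"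
  define u where "u = (\<lambda>s. p s * D x s)"
  have diff: "x differentiable_on I" "u differentiable_on I"
    using assms(8) by (simp_all add: conformable_domain_def u_def D_def)
  have z: "z t = u t / x t" if "t \<in> I" for t
    using assms(10)[OF that] by (simp add: u_def D_def)
  have "\<exists>z'. (z has_real_derivative z') (at t within I) \<and>
      conformable_L I (\<kappa>0 \<alpha>) (\<kappa>1 \<alpha>) p q x t = x t * riccati I (\<kappa>0 \<alpha>) (\<kappa>1 \<alpha>) p q z t"
    if t: "t \<in> I" for t
  proof -
    obtain x' u' where x': "(x has_real_derivative x') (at t within I)"
      and u': "(u has_real_derivative u') (at t within I)"
      using diff t by (meson differentiable_on_def real_differentiableE)
    have x0: "x t \<noteq> 0" and p0: "p t \<noteq> 0"
      using assms(7,9)[OF t] by auto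
    \<comment> \<open>\<open>z\<close> is known to equal \<open>u / x\<close> only on
      \<open>I\<close>, so the quotient rule is transferred along this agreement; the radius 1 is
      arbitrary.\<close>
    have z': "(z has_real_derivative (u' * x t - u t * x') / (x t * x t)) (at t within I)"
      using DERIV_divide[OF u' x' x0] zero_less_one t
      by (rule has_field_derivative_transform_within) (simp add: z)
    have Dx: "D x t = \<kappa>1 \<alpha> t * x t + \<kappa>0 \<alpha> t * x'"
      unfolding D_def by (rule conformable_deriv_eq[OF assms(1) t x'])
    have Du: "D u t = \<kappa>1 \<alpha> t * u t + \<kappa>0 \<alpha> t * u'"
      unfolding D_def by (rule conformable_deriv_eq[OF assms(1) t u'])
    have Dz: "D z t = \<kappa>1 \<alpha> t * z t + \<kappa>0 \<alpha> t * ((u' * x t - u t * x') / (x t * x t))"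
      unfolding D_def by (rule conformable_deriv_eq[OF assms(1) t z'])
    \<comment> \<open>\<open>D x t\<close> is left folded here: one factor \<open>u t\<close> of the
      square is written as \<open>p t * D x t\<close>, which cancels \<open>p t\<close>.\<close>
    have "x t * (D z t + q t + (z t)\<^sup>2 / p t - \<kappa>1 \<alpha> t * z t)
        = \<kappa>0 \<alpha> t * u' - \<kappa>0 \<alpha> t * u t * x' / x t + q t * x t + u t * D x t / x t"
      unfolding Dz using x0 p0 by (simp add: z t u_def field_simps power2_eq_square)
    \<comment> \<open>Expanding \<open>D x t\<close> now yields the missing
      \<open>\<kappa>1 \<alpha> t * u t\<close> and cancels the term with \<open>x'\<close>.\<close>
    also have "\<dots> = D u t + q t * x t"
      unfolding Dx Du using x0 by (simp add: field_simps)
    finally show ?thesis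
      using z' by (auto simp: conformable_L_def riccati_def D_def u_def)
  qed
  then show ?thesis
    unfolding differentiable_on_def real_differentiable_def by blast
qed

end
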